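(* Let $A$ be a commutative ring with nonzero identity, let $M$ be an $A$-module and $P$ a proper submodule of $M$. The following statements are equivalent. (i) $P$ is a classical 1-absorbing prime submodule of $M$. (ii) For all nonunits $a,b,c\in A$, $(P:_{M}abc)=(P:_{M}ab)\cup(P:_{M}c)$. (iii) For all nonunits $a,b\in A$ and $m\in M$ with $abm\notin P$, $(P:_{A}abm)=(P:_{A}m)$. (iv) For all nonunits $a,b\in A$, every proper ideal $I$ of $A$ and every $m\in M$ with $aIbm\subseteq P$, either $aIm\subseteq P$ or $bm\in P$. (v) For every nonunit $a\in A$, every proper ideal $I$ of $A$ and every $m\in M$ with $aIm\nsubseteq P$, $(P:_{A}aIm)=(P:_{A}m)$. (vi) For every nonunit $a\in A$, all proper ideals $I,J$ of $A$ and every $m\in M$ with $aIJm\subseteq P$, either $aIm\subseteq P$ or $Jm\subseteq P$. (vii) For all proper ideals $I,J$ of $A$ and every $m\in M$ with $IJm\nsubseteq P$, $(P:_{A}IJm)=(P:_{A}m)$. (viii) For all proper ideals $I,J,K$ of $A$ and every $m\in M$ with $IJKm\subseteq P$, either $IJm\subseteq P$ or $Km\subseteq P$. (ix) For every $m\in M\setminus P$, $(P:_{A}m)$ is a 1-absorbing prime ideal of $A$.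
   Context: All rings are commutative with nonzero identity; the given module $M$ is nonzero and unital. A proper submodule $P$ of an $A$-module $M$ is a classical 1-absorbing prime submodule if whenever $abcm\in P$ for nonunits $a,b,c\in A$ and $m\in M$, then $abm\in P$ or $cm\in P$. A proper ideal $I$ of $A$ is a 1-absorbing prime ideal if whenever $abc\in I$ for nonunits $a,b,c\in A$, then $ab\in I$ or $c\in I$. For a submodule $P$ of $M$: $(P:_{M}x)=\{m\in M: xm\in P\}$ for $x\in A$; $(P:_{A}K)=\{a\in A: aK\subseteq P\}$ for a subset $K\subseteq M$, and $(P:_{A}m)=(P:_A\{m\})$ for $m\in M$. *)

theory Defs
  imports "HOL-Algebra.Module" "HOL-Algebra.Ideal_Product"
begin

definition nonunits :: "('a, 'x) ring_scheme \<Rightarrow> 'a set"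
  where "nonunits A = carrier A - Units A"

definition proper_ideal :: "'a set \<Rightarrow> ('a, 'x) ring_scheme \<Rightarrow> bool"
  where "proper_ideal I A \<longleftrightarrow> ideal I A \<and> I \<noteq> carrier A"

definition proper_submodule ::
    "'m set \<Rightarrow> ('a, 'x) ring_scheme \<Rightarrow> ('a, 'm, 'y) module_scheme \<Rightarrow> bool"
  where "proper_submodule P A M \<longleftrightarrow> submodule P A M \<and> P \<noteq> carrier M"

definition one_absorbing_prime_ideal :: "'a set \<Rightarrow> ('a, 'x) ring_scheme \<Rightarrow> bool"
  where "one_absorbing_prime_ideal I A \<longleftrightarrow>
    proper_ideal I A \<and>
    (\<forall>a \<in> nonunits A. \<forall>b \<in> nonunits A. \<forall>c \<in> nonunits A.
       a \<otimes>\<^bsub>A\<^esub> b \<otimes>\<^bsub>A\<^esub> c \<in> I \<longrightarrow> a \<otimes>\<^bsub>A\<^esub> b \<in> I \<or> c \<in> I)"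

definition classical_one_absorbing_prime_submodule ::
    "'m set \<Rightarrow> ('a, 'x) ring_scheme \<Rightarrow> ('a, 'm, 'y) module_scheme \<Rightarrow> bool"
  where "classical_one_absorbing_prime_submodule P A M \<longleftrightarrow>
    proper_submodule P A M \<and>
    (\<forall>a \<in> nonunits A. \<forall>b \<in> nonunits A. \<forall>c \<in> nonunits A. \<forall>m \<in> carrier M.
       (a \<otimes>\<^bsub>A\<^esub> b \<otimes>\<^bsub>A\<^esub> c) \<odot>\<^bsub>M\<^esub> m \<in> P \<longrightarrow>
       (a \<otimes>\<^bsub>A\<^esub> b) \<odot>\<^bsub>M\<^esub> m \<in> P \<or> c \<odot>\<^bsub>M\<^esub> m \<in> P)"

text \<open>The residuals \<open>(P :\<^sub>M x)\<close> and \<open>(P :\<^sub>A K)\<close>; for an element \<open>m\<close> of the module,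
  \<open>(P :\<^sub>A m)\<close> is \<open>ring_residual A M P {m}\<close>.\<close>

definition module_residual :: "('a, 'm, 'y) module_scheme \<Rightarrow> 'm set \<Rightarrow> 'a \<Rightarrow> 'm set"
  where "module_residual M P x = {m \<in> carrier M. x \<odot>\<^bsub>M\<^esub> m \<in> P}"

definition ring_residual ::
    "('a, 'x) ring_scheme \<Rightarrow> ('a, 'm, 'y) module_scheme \<Rightarrow> 'm set \<Rightarrow> 'm set \<Rightarrow> 'a set"
  where "ring_residual A M P K = {a \<in> carrier A. \<forall>k \<in> K. a \<odot>\<^bsub>M\<^esub> k \<in> P}"

text \<open>The product \<open>I m\<close>. If \<open>I\<close> is an ideal, the set of multiples \<open>x m\<close> with \<open>x \<in> I\<close>
  is already a submodule, so no closure under sums is needed. Products such as \<open>a I m\<close> and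
  \<open>I J m\<close> are written as \<open>(a I) m\<close> and \<open>(I J) m\<close>, where \<open>a I\<close> is the set \<open>a <# I\<close> of
  multiples and \<open>I J\<close> is the ideal product.\<close>

definition set_smult :: "('a, 'm, 'y) module_scheme \<Rightarrow> 'a set \<Rightarrow> 'm \<Rightarrow> 'm set"
  where "set_smult M I m = {x \<odot>\<^bsub>M\<^esub> m | x. x \<in> I}"

end

theory Submission
  imports Defs
begin

text \<open>
  Every one of the conditions speaks about a single \<open>m\<close> at a time and sees the submodule \<open>P\<close>
  only through the ideal \<open>Q = (P :\<^sub>A m)\<close>: for a set \<open>S\<close> of scalars, \<open>S m \<subseteq> P\<close> means
  \<open>S \<subseteq> Q\<close>, and \<open>(P :\<^sub>A S m)\<close> is the ideal quotient \<open>(Q : S)\<close>. The theorem therefore reduces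
  to equivalences about one ideal \<open>Q\<close> of a commutative ring, namely that the implication
  \<open>abc \<in> Q \<Longrightarrow> ab \<in> Q \<or> c \<in> Q\<close> for nonunits has versions in which some elements are replaced by
  proper ideals. The ideal \<open>Q\<close> is the whole ring exactly if \<open>m \<in> P\<close>, and then all the versions hold
  trivially; this is why the condition on 1-absorbing prime ideals concerns only \<open>m \<notin> P\<close>.

  From elements to ideals: a proper ideal consists of nonunits, and if a set such as \<open>aI\<close> or \<open>IJ\<close>
  is not contained in \<open>Q\<close>, then already one product \<open>ab\<close> of two nonunits in it lies outside \<open>Q\<close>
  (\<open>ideal_prod_subset_iff\<close> handles the sums in \<open>IJ\<close>). Any \<open>x\<close> that multiplies this product into
  \<open>Q\<close> must lie in \<open>Q\<close> (\<open>one_absorbing_cancel\<close>); this is the hypothesis if \<open>x\<close> is a nonunit, and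
  impossible if \<open>x\<close> is a unit.

  From ideals to elements: a nonunit generates a proper principal ideal, and products of principal
  ideals lie in the principal ideal of the product, so that membership of \<open>abc\<close> in \<open>Q\<close> forces the
  whole product of ideals into \<open>Q\<close>.
\<close>

section \<open>Nonunits, proper ideals and products of ideals\<close>

lemma (in ring) unit_mult_mem_ideal_cancel:
  assumes "ideal Q R" "u \<in> Units R" "p \<in> carrier R" "u \<otimes> p \<in> Q"
  shows "p \<in> Q"
proof -
  have "inv u \<otimes> (u \<otimes> p) \<in> Q"
    using ideal.I_l_closed[OF assms(1,4)] assms(2) by simp
  also have "inv u \<otimes> (u \<otimes> p) = p"
    using assms(2,3) by (simp add: m_assoc[symmetric] Units_closed)
  finally show ?thesis .
qed

lemma (in ring) proper_ideal_subset_nonunits: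
  assumes "proper_ideal I R"
  shows "I \<subseteq> nonunits R"
proof
  fix x assume x: "x \<in> I"
  have I: "ideal I R" and ne: "I \<noteq> carrier R"
    using assms by (auto simp: proper_ideal_def)
  have "x \<notin> Units R"
  proof
    assume "x \<in> Units R"
    then have "\<one> \<in> I"
      using unit_mult_mem_ideal_cancel[OF I, of x \<one>] x ideal.Icarr[OF I x] by simp
    then show False
      using ideal.one_imp_carrier[OF I] ne by simp
  qed
  then show "x \<in> nonunits R"
    using ideal.Icarr[OF I x] by (simp add: nonunits_def)
qed

lemma (in cring) proper_ideal_cgenideal:
  assumes "a \<in> nonunits R"
  shows "proper_ideal (PIdl a) R"
proof -
  have a: "a \<in> carrier R" "a \<notin> Units R"
    using assms by (auto simp: nonunits_def)
  have "\<one> \<notin> PIdl a"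
  proof
    assume "\<one> \<in> PIdl a"
    then obtain x where "x \<in> carrier R" "\<one> = x \<otimes> a"
      by (auto simp: cgenideal_def)
    then have "a \<in> Units R"
      using a by (auto simp: Units_def m_comm)
    then show False
      using a by simp
  qed
  then show ?thesis
    using cgenideal_ideal[OF a(1)] by (auto simp: proper_ideal_def)
qed

lemma (in ring) ideal_prod_subset_iff:
  assumes "ideal Q R"
  shows "I \<cdot> J \<subseteq> Q \<longleftrightarrow> (\<forall>i \<in> I. \<forall>j \<in> J. i \<otimes> j \<in> Q)"
proof
  assume "I \<cdot> J \<subseteq> Q"
  then show "\<forall>i \<in> I. \<forall>j \<in> J. i \<otimes> j \<in> Q"
    by (auto intro: ideal_prod.prod)
next
  assume *: "\<forall>i \<in> I. \<forall>j \<in> J. i \<otimes> j \<in> Q"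
  show "I \<cdot> J \<subseteq> Q"
  proof
    fix s assume "s \<in> I \<cdot> J"
    then show "s \<in> Q"
      by induction
        (use * additive_subgroup.a_closed[OF ideal.axioms(1)[OF assms]] in auto)
  qed
qed

lemma (in cring) l_coset_cgenideal_subset:
  assumes "a \<in> carrier R" "b \<in> carrier R"
  shows "a <# (PIdl b) \<subseteq> PIdl (a \<otimes> b)"
  using assms by (auto simp: l_coset_def cgenideal_def m_lcomm)

lemma (in cring) r_coset_cgenideal_subset:
  assumes "a \<in> carrier R" "b \<in> carrier R"
  shows "(PIdl a) #> b \<subseteq> PIdl (a \<otimes> b)"
  using assms by (auto simp: r_coset_def cgenideal_def m_assoc)

lemma (in cring) ideal_prod_cgenideal_subset:
  assumes "a \<in> carrier R" "b \<in> carrier R"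
  shows "(PIdl a) \<cdot> (PIdl b) \<subseteq> PIdl (a \<otimes> b)"
proof -
  have "i \<otimes> j \<in> PIdl (a \<otimes> b)" if ij: "i \<in> PIdl a" "j \<in> PIdl b" for i j
  proof -
    obtain x y where xy: "x \<in> carrier R" "i = x \<otimes> a" "y \<in> carrier R" "j = y \<otimes> b"
      using ij by (auto simp: cgenideal_def)
    then have "i \<otimes> j = (x \<otimes> y) \<otimes> (a \<otimes> b)"
      using assms by (simp add: m_ac)
    then show ?thesis
      using xy by (auto simp: cgenideal_def)
  qed
  then show ?thesis
    using assms by (simp add: ideal_prod_subset_iff cgenideal_ideal)
qed

lemma (in ring) ideal_prod_mono:
  assumes "I \<subseteq> I'"
  shows "I \<cdot> J \<subseteq> I' \<cdot> J"
proof
  fix s assume "s \<in> I \<cdot> J"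
  then show "s \<in> I' \<cdot> J"
    by induction (use assms in \<open>auto intro: ideal_prod.intros\<close>)
qed

section \<open>The absorbing condition and ideal quotients\<close>

text \<open>Properness is left out so that the residual ideal of an \<open>m \<in> P\<close>, which is the whole ring,
  satisfies the condition too.\<close>

definition one_absorbing :: "('a, 'x) ring_scheme \<Rightarrow> 'a set \<Rightarrow> bool"
  where "one_absorbing A Q \<longleftrightarrow>
    (\<forall>a \<in> nonunits A. \<forall>b \<in> nonunits A. \<forall>c \<in> nonunits A.
       a \<otimes>\<^bsub>A\<^esub> b \<otimes>\<^bsub>A\<^esub> c \<in> Q \<longrightarrow> a \<otimes>\<^bsub>A\<^esub> b \<in> Q \<or> c \<in> Q)"

definition ideal_quotient :: "('a, 'x) ring_scheme \<Rightarrow> 'a set \<Rightarrow> 'a set \<Rightarrow> 'a set"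
  where "ideal_quotient A Q S = {x \<in> carrier A. \<forall>s \<in> S. x \<otimes>\<^bsub>A\<^esub> s \<in> Q}"

text \<open>A unit \<open>x\<close> could be cancelled from \<open>abx \<in> Q\<close>, so the absorbing property, which is only
  about nonunits, extends to an arbitrary third factor.\<close>

lemma (in cring) one_absorbing_cancel:
  assumes "ideal Q R" "one_absorbing R Q"
    and "a \<in> nonunits R" "b \<in> nonunits R" "x \<in> carrier R"
    and "a \<otimes> b \<notin> Q" "a \<otimes> b \<otimes> x \<in> Q"
  shows "x \<in> Q"
proof (cases "x \<in> Units R")
  case True
  have ab: "a \<otimes> b \<in> carrier R"
    using assms(3,4) by (simp add: nonunits_def)
  then have "x \<otimes> (a \<otimes> b) \<in> Q"
    using assms(5,7) by (simp add: m_comm)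
  then show ?thesis
    using unit_mult_mem_ideal_cancel[OF assms(1) True ab] assms(6) by blast
next
  case False
  then show ?thesis
    using assms by (auto simp: one_absorbing_def nonunits_def)
qed

lemma (in cring) ideal_quotient_eq_of_one_absorbing:
  assumes Q: "ideal Q R" "one_absorbing R Q" and S: "S \<subseteq> carrier R"
    and ab: "a \<in> nonunits R" "b \<in> nonunits R" "a \<otimes> b \<in> S" "a \<otimes> b \<notin> Q"
  shows "ideal_quotient R Q S = Q"
proof
  show "ideal_quotient R Q S \<subseteq> Q"
  proof
    fix x assume "x \<in> ideal_quotient R Q S"
    then have x: "x \<in> carrier R" "x \<otimes> (a \<otimes> b) \<in> Q"
      using ab(3) by (auto simp: ideal_quotient_def)
    have "a \<otimes> b \<in> carrier R"
      using S ab(3) by blast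
    then have "a \<otimes> b \<otimes> x \<in> Q"
      using x by (simp add: m_comm)
    then show "x \<in> Q"
      using one_absorbing_cancel[OF Q ab(1,2) x(1) ab(4)] by blast
  qed
  show "Q \<subseteq> ideal_quotient R Q S"
    using S ideal.I_r_closed[OF Q(1)] ideal.Icarr[OF Q(1)]
    by (auto simp: ideal_quotient_def)
qed

text \<open>This brings a condition on ideal quotients back to elements. The set \<open>S\<close> stands for any of
  \<open>{p}\<close>, \<open>aI\<close>, \<open>IJ\<close> where \<open>p = ab\<close> and \<open>I\<close>, \<open>J\<close> are generated by \<open>b\<close> or by \<open>a\<close>, \<open>b\<close>: each contains
  \<open>p\<close> and consists of multiples of \<open>p\<close>, so \<open>c\<close> multiplies all of \<open>S\<close> into \<open>Q\<close> as soon as it does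
  so for \<open>p\<close>.\<close>

lemma (in cring) absorb_of_ideal_quotient:
  assumes Q: "ideal Q R" and c: "c \<in> carrier R" and p: "p \<in> carrier R" "p \<in> S" "S \<subseteq> PIdl p"
    and quot: "\<not> S \<subseteq> Q \<Longrightarrow> ideal_quotient R Q S = Q"
    and pc: "p \<otimes> c \<in> Q"
  shows "p \<in> Q \<or> c \<in> Q"
proof (cases "S \<subseteq> Q")
  case False
  have "c \<otimes> s \<in> Q" if s: "s \<in> S" for s
  proof -
    obtain x where x: "x \<in> carrier R" "s = x \<otimes> p"
      using p(3) s by (auto simp: cgenideal_def)
    then have "c \<otimes> s = x \<otimes> (p \<otimes> c)"
      using c p(1) by (simp add: m_ac)
    then show ?thesis
      using ideal.I_l_closed[OF Q pc x(1)] by simp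
  qed
  then have "c \<in> ideal_quotient R Q S"
    using c by (simp add: ideal_quotient_def)
  then show ?thesis
    using quot False by simp
qed (use p in auto)

text \<open>The counterpart for a condition on triple products: \<open>T\<close> is a product such as \<open>aIb\<close>, \<open>aIJ\<close> or
  \<open>IJK\<close> of elements and principal ideals, so it consists of multiples of the product \<open>pc\<close> of the
  generators, while \<open>S\<close> and \<open>K\<close> contain the factors \<open>p\<close> and \<open>c\<close>.\<close>

lemma (in cring) absorb_of_subset_ideal:
  assumes Q: "ideal Q R" and T: "T \<subseteq> PIdl (p \<otimes> c)" and pc: "p \<otimes> c \<in> Q"
    and absorb: "T \<subseteq> Q \<Longrightarrow> S \<subseteq> Q \<or> K \<subseteq> Q"
    and mem: "p \<in> S" "c \<in> K"
  shows "p \<in> Q \<or> c \<in> Q"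
  using absorb mem T cgenideal_minimal[OF Q pc] by blast

section \<open>Replacing elements by proper ideals\<close>

text \<open>Products with one factor in an ideal stay in it, so the implication is an equivalence.\<close>

lemma (in cring) one_absorbing_iff_union:
  assumes Q: "ideal Q R"
  shows "one_absorbing R Q \<longleftrightarrow>
    (\<forall>a \<in> nonunits R. \<forall>b \<in> nonunits R. \<forall>c \<in> nonunits R.
       a \<otimes> b \<otimes> c \<in> Q \<longleftrightarrow> a \<otimes> b \<in> Q \<or> c \<in> Q)"
proof -
  have "a \<otimes> b \<otimes> c \<in> Q"
    if "a \<in> nonunits R" "b \<in> nonunits R" "c \<in> nonunits R" "a \<otimes> b \<in> Q \<or> c \<in> Q" for a b c
  proof -
    have "a \<otimes> b \<in> carrier R" "c \<in> carrier R"
      using that by (auto simp: nonunits_def)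
    then show ?thesis
      using that(4) ideal.I_l_closed[OF Q] ideal.I_r_closed[OF Q] by blast
  qed
  then show ?thesis
    unfolding one_absorbing_def by blast
qed

lemma (in cring) one_absorbing_iff_quotient_element:
  assumes Q: "ideal Q R"
  shows "one_absorbing R Q \<longleftrightarrow>
    (\<forall>a \<in> nonunits R. \<forall>b \<in> nonunits R.
       a \<otimes> b \<notin> Q \<longrightarrow> ideal_quotient R Q {a \<otimes> b} = Q)"
    (is "_ \<longleftrightarrow> ?quot")
proof
  assume abs: "one_absorbing R Q"
  show ?quot
    by (intro ballI impI ideal_quotient_eq_of_one_absorbing[OF Q abs])
      (auto simp: nonunits_def)
next
  assume quot: ?quot
  show "one_absorbing R Q"
    unfolding one_absorbing_def
  proof (intro ballI impI)
    fix a b c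
    assume abc: "a \<in> nonunits R" "b \<in> nonunits R" "c \<in> nonunits R" "a \<otimes> b \<otimes> c \<in> Q"
    then have carr: "a \<in> carrier R" "b \<in> carrier R" "c \<in> carrier R"
      by (auto simp: nonunits_def)
    show "a \<otimes> b \<in> Q \<or> c \<in> Q"
      by (rule absorb_of_ideal_quotient[OF Q carr(3), where S = "{a \<otimes> b}"])
        (use quot abc carr in \<open>auto simp: cgenideal_self\<close>)
  qed
qed

text \<open>The absorbing property is about single products, so each passage to ideals starts from a
  product of two nonunits in \<open>aI\<close> or \<open>IJ\<close> that lies outside \<open>Q\<close>. In \<open>IJ\<close> such a product exists
  because \<open>Q\<close> is closed under sums.\<close>

lemma (in ring) l_coset_not_subset_obtain:
  assumes "proper_ideal I R" "\<not> a <# I \<subseteq> Q"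
  obtains i where "i \<in> I" "i \<in> nonunits R" "a \<otimes> i \<in> a <# I" "a \<otimes> i \<notin> Q"
  using assms proper_ideal_subset_nonunits[OF assms(1)] by (auto simp: l_coset_def)

lemma (in ring) ideal_prod_not_subset_obtain:
  assumes "ideal Q R" "proper_ideal I R" "proper_ideal J R" "\<not> I \<cdot> J \<subseteq> Q"
  obtains i j where "i \<in> I" "j \<in> J" "i \<in> nonunits R" "j \<in> nonunits R"
    "i \<otimes> j \<in> I \<cdot> J" "i \<otimes> j \<notin> Q"
proof -
  obtain i j where ij: "i \<in> I" "j \<in> J" "i \<otimes> j \<notin> Q"
    using assms(4) by (auto simp: ideal_prod_subset_iff[OF assms(1)])
  show thesis
    by (rule that[OF ij(1,2) _ _ ideal_prod.prod[OF ij(1,2)] ij(3)])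
      (use ij proper_ideal_subset_nonunits[OF assms(2)]
        proper_ideal_subset_nonunits[OF assms(3)] in auto)
qed

lemma proper_ideal_subset_carrier: "proper_ideal I R \<Longrightarrow> I \<subseteq> carrier R"
  by (auto simp: proper_ideal_def dest: ideal.Icarr)

lemma (in monoid) l_coset_subset_carrier:
  "a \<in> carrier G \<Longrightarrow> I \<subseteq> carrier G \<Longrightarrow> a <# I \<subseteq> carrier G"
  by (auto simp: l_coset_def)

lemma (in cring) one_absorbing_iff_element_ideal_element:
  assumes Q: "ideal Q R"
  shows "one_absorbing R Q \<longleftrightarrow>
    (\<forall>a \<in> nonunits R. \<forall>b \<in> nonunits R. \<forall>I. proper_ideal I R \<longrightarrow>
       (a <# I) #> b \<subseteq> Q \<longrightarrow> a <# I \<subseteq> Q \<or> b \<in> Q)"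
    (is "_ \<longleftrightarrow> ?prod")
proof
  assume abs: "one_absorbing R Q"
  show ?prod
  proof (intro ballI allI impI)
    fix a b I
    assume ab: "a \<in> nonunits R" "b \<in> nonunits R" and I: "proper_ideal I R"
      and sub: "(a <# I) #> b \<subseteq> Q"
    have "b \<in> Q" if not_sub: "\<not> a <# I \<subseteq> Q"
    proof -
      obtain i where i: "i \<in> nonunits R" "a \<otimes> i \<in> a <# I" "a \<otimes> i \<notin> Q"
        using l_coset_not_subset_obtain[OF I not_sub] by blast
      have "a \<otimes> i \<otimes> b \<in> Q"
        using sub i(2) by (auto simp: r_coset_def)
      then show ?thesis
        using abs ab i unfolding one_absorbing_def by blast
    qed
    then show "a <# I \<subseteq> Q \<or> b \<in> Q"
      by blast
  qed
next
  assume prod: ?prod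
  show "one_absorbing R Q"
    unfolding one_absorbing_def
  proof (intro ballI impI)
    fix a b c
    assume abc: "a \<in> nonunits R" "b \<in> nonunits R" "c \<in> nonunits R" "a \<otimes> b \<otimes> c \<in> Q"
    then have carr: "a \<in> carrier R" "b \<in> carrier R" "c \<in> carrier R"
      by (auto simp: nonunits_def)
    have T: "(a <# (PIdl b)) #> c \<subseteq> PIdl (a \<otimes> b \<otimes> c)"
    proof -
      have "(a <# (PIdl b)) #> c \<subseteq> (PIdl (a \<otimes> b)) #> c"
        using l_coset_cgenideal_subset[OF carr(1,2)] by (auto simp: r_coset_def)
      then show ?thesis
        using r_coset_cgenideal_subset[of "a \<otimes> b" c] carr by simp
    qed
    show "a \<otimes> b \<in> Q \<or> c \<in> Q"
    proof (rule absorb_of_subset_ideal[OF Q T abc(4)])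
      assume "(a <# (PIdl b)) #> c \<subseteq> Q"
      then show "a <# (PIdl b) \<subseteq> Q \<or> {c} \<subseteq> Q"
        using prod abc(1,3) proper_ideal_cgenideal[OF abc(2)] by blast
    next
      show "a \<otimes> b \<in> a <# (PIdl b)"
        using cgenideal_self[OF carr(2)] by (auto simp: l_coset_def)
    qed simp
  qed
qed

lemma (in cring) one_absorbing_iff_quotient_element_ideal:
  assumes Q: "ideal Q R"
  shows "one_absorbing R Q \<longleftrightarrow>
    (\<forall>a \<in> nonunits R. \<forall>I. proper_ideal I R \<longrightarrow>
       \<not> a <# I \<subseteq> Q \<longrightarrow> ideal_quotient R Q (a <# I) = Q)"
    (is "_ \<longleftrightarrow> ?quot")
proof
  assume abs: "one_absorbing R Q"
  show ?quot
  proof (intro ballI allI impI)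
    fix a I
    assume a: "a \<in> nonunits R" and I: "proper_ideal I R" and not_sub: "\<not> a <# I \<subseteq> Q"
    obtain i where i: "i \<in> nonunits R" "a \<otimes> i \<in> a <# I" "a \<otimes> i \<notin> Q"
      using l_coset_not_subset_obtain[OF I not_sub] by blast
    have "a <# I \<subseteq> carrier R"
      using a l_coset_subset_carrier proper_ideal_subset_carrier[OF I]
      by (simp add: nonunits_def)
    then show "ideal_quotient R Q (a <# I) = Q"
      using ideal_quotient_eq_of_one_absorbing[OF Q abs _ a i] by blast
  qed
next
  assume quot: ?quot
  show "one_absorbing R Q"
    unfolding one_absorbing_def
  proof (intro ballI impI)
    fix a b c
    assume abc: "a \<in> nonunits R" "b \<in> nonunits R" "c \<in> nonunits R" "a \<otimes> b \<otimes> c \<in> Q"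
    then have carr: "a \<in> carrier R" "b \<in> carrier R" "c \<in> carrier R"
      by (auto simp: nonunits_def)
    have "a \<otimes> b \<in> a <# (PIdl b)"
      using cgenideal_self[OF carr(2)] by (auto simp: l_coset_def)
    then show "a \<otimes> b \<in> Q \<or> c \<in> Q"
      using absorb_of_ideal_quotient[OF Q carr(3) m_closed[OF carr(1,2)] _
          l_coset_cgenideal_subset[OF carr(1,2)] _ abc(4)]
        quot abc(1) proper_ideal_cgenideal[OF abc(2)]
      by blast
  qed
qed

lemma (in cring) one_absorbing_iff_element_ideal_ideal:
  assumes Q: "ideal Q R"
  shows "one_absorbing R Q \<longleftrightarrow>
    (\<forall>a \<in> nonunits R. \<forall>I J. proper_ideal I R \<longrightarrow> proper_ideal J R \<longrightarrow>
       a <# (I \<cdot> J) \<subseteq> Q \<longrightarrow> a <# I \<subseteq> Q \<or> J \<subseteq> Q)"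
    (is "_ \<longleftrightarrow> ?prod")
proof
  assume abs: "one_absorbing R Q"
  show ?prod
  proof (intro ballI allI impI)
    fix a I J
    assume a: "a \<in> nonunits R" and IJ: "proper_ideal I R" "proper_ideal J R"
      and sub: "a <# (I \<cdot> J) \<subseteq> Q"
    have "J \<subseteq> Q" if not_sub: "\<not> a <# I \<subseteq> Q"
    proof
      fix j assume j: "j \<in> J"
      obtain i where i: "i \<in> I" "i \<in> nonunits R" "a \<otimes> i \<notin> Q"
        using l_coset_not_subset_obtain[OF IJ(1) not_sub] by blast
      have jn: "j \<in> nonunits R"
        using proper_ideal_subset_nonunits[OF IJ(2)] j by blast
      have "a \<otimes> (i \<otimes> j) \<in> Q"
        using sub ideal_prod.prod[OF i(1) j, of R] by (auto simp: l_coset_def)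
      then have "a \<otimes> i \<otimes> j \<in> Q"
        using a i(2) jn by (simp add: nonunits_def m_assoc)
      then show "j \<in> Q"
        using abs a i jn unfolding one_absorbing_def by blast
    qed
    then show "a <# I \<subseteq> Q \<or> J \<subseteq> Q"
      by blast
  qed
next
  assume prod: ?prod
  show "one_absorbing R Q"
    unfolding one_absorbing_def
  proof (intro ballI impI)
    fix a b c
    assume abc: "a \<in> nonunits R" "b \<in> nonunits R" "c \<in> nonunits R" "a \<otimes> b \<otimes> c \<in> Q"
    then have carr: "a \<in> carrier R" "b \<in> carrier R" "c \<in> carrier R"
      by (auto simp: nonunits_def)
    have T: "a <# ((PIdl b) \<cdot> (PIdl c)) \<subseteq> PIdl (a \<otimes> b \<otimes> c)"
    proof -
      have "a <# ((PIdl b) \<cdot> (PIdl c)) \<subseteq> a <# (PIdl (b \<otimes> c))"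
        using ideal_prod_cgenideal_subset[OF carr(2,3)] by (auto simp: l_coset_def)
      then show ?thesis
        using l_coset_cgenideal_subset[of a "b \<otimes> c"] carr by (simp add: m_assoc)
    qed
    show "a \<otimes> b \<in> Q \<or> c \<in> Q"
    proof (rule absorb_of_subset_ideal[OF Q T abc(4)])
      assume "a <# ((PIdl b) \<cdot> (PIdl c)) \<subseteq> Q"
      then show "a <# (PIdl b) \<subseteq> Q \<or> (PIdl c) \<subseteq> Q"
        using prod abc(1) proper_ideal_cgenideal[OF abc(2)] proper_ideal_cgenideal[OF abc(3)]
        by blast
    next
      show "a \<otimes> b \<in> a <# (PIdl b)"
        using cgenideal_self[OF carr(2)] by (auto simp: l_coset_def)
      show "c \<in> PIdl c"
        using cgenideal_self[OF carr(3)] .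
    qed
  qed
qed

lemma (in cring) one_absorbing_iff_quotient_ideal_ideal:
  assumes Q: "ideal Q R"
  shows "one_absorbing R Q \<longleftrightarrow>
    (\<forall>I J. proper_ideal I R \<longrightarrow> proper_ideal J R \<longrightarrow>
       \<not> I \<cdot> J \<subseteq> Q \<longrightarrow> ideal_quotient R Q (I \<cdot> J) = Q)"
    (is "_ \<longleftrightarrow> ?quot")
proof
  assume abs: "one_absorbing R Q"
  show ?quot
  proof (intro allI impI)
    fix I J
    assume IJ: "proper_ideal I R" "proper_ideal J R" and not_sub: "\<not> I \<cdot> J \<subseteq> Q"
    obtain i j where ij: "i \<in> nonunits R" "j \<in> nonunits R" "i \<otimes> j \<in> I \<cdot> J" "i \<otimes> j \<notin> Q"
      using ideal_prod_not_subset_obtain[OF Q IJ not_sub] by blast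
    have "I \<cdot> J \<subseteq> carrier R"
      using IJ by (simp add: proper_ideal_def ideal_prod_in_carrier)
    then show "ideal_quotient R Q (I \<cdot> J) = Q"
      using ideal_quotient_eq_of_one_absorbing[OF Q abs _ ij] by blast
  qed
next
  assume quot: ?quot
  show "one_absorbing R Q"
    unfolding one_absorbing_def
  proof (intro ballI impI)
    fix a b c
    assume abc: "a \<in> nonunits R" "b \<in> nonunits R" "c \<in> nonunits R" "a \<otimes> b \<otimes> c \<in> Q"
    then have carr: "a \<in> carrier R" "b \<in> carrier R" "c \<in> carrier R"
      by (auto simp: nonunits_def)
    have "a \<otimes> b \<in> (PIdl a) \<cdot> (PIdl b)"
      using carr by (simp add: cgenideal_self ideal_prod.prod)
    then show "a \<otimes> b \<in> Q \<or> c \<in> Q"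
      using absorb_of_ideal_quotient[OF Q carr(3) m_closed[OF carr(1,2)] _
          ideal_prod_cgenideal_subset[OF carr(1,2)] _ abc(4)]
        quot proper_ideal_cgenideal[OF abc(1)] proper_ideal_cgenideal[OF abc(2)]
      by blast
  qed
qed

lemma (in cring) one_absorbing_iff_ideal_ideal_ideal:
  assumes Q: "ideal Q R"
  shows "one_absorbing R Q \<longleftrightarrow>
    (\<forall>I J K. proper_ideal I R \<longrightarrow> proper_ideal J R \<longrightarrow> proper_ideal K R \<longrightarrow>
       I \<cdot> J \<cdot> K \<subseteq> Q \<longrightarrow> I \<cdot> J \<subseteq> Q \<or> K \<subseteq> Q)"
    (is "_ \<longleftrightarrow> ?prod")
proof
  assume abs: "one_absorbing R Q"
  show ?prod
  proof (intro allI impI)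
    fix I J K
    assume IJK: "proper_ideal I R" "proper_ideal J R" "proper_ideal K R"
      and sub: "I \<cdot> J \<cdot> K \<subseteq> Q"
    have "K \<subseteq> Q" if not_sub: "\<not> I \<cdot> J \<subseteq> Q"
    proof
      fix k assume k: "k \<in> K"
      obtain i j where ij: "i \<in> nonunits R" "j \<in> nonunits R" "i \<otimes> j \<in> I \<cdot> J" "i \<otimes> j \<notin> Q"
        using ideal_prod_not_subset_obtain[OF Q IJK(1,2) not_sub] by blast
      have "i \<otimes> j \<otimes> k \<in> Q"
        using sub ideal_prod.prod[OF ij(3) k] by blast
      then show "k \<in> Q"
        using abs ij k proper_ideal_subset_nonunits[OF IJK(3)]
        unfolding one_absorbing_def by blast
    qed
    then show "I \<cdot> J \<subseteq> Q \<or> K \<subseteq> Q"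
      by blast
  qed
next
  assume prod: ?prod
  show "one_absorbing R Q"
    unfolding one_absorbing_def
  proof (intro ballI impI)
    fix a b c
    assume abc: "a \<in> nonunits R" "b \<in> nonunits R" "c \<in> nonunits R" "a \<otimes> b \<otimes> c \<in> Q"
    then have carr: "a \<in> carrier R" "b \<in> carrier R" "c \<in> carrier R"
      by (auto simp: nonunits_def)
    have T: "(PIdl a) \<cdot> (PIdl b) \<cdot> (PIdl c) \<subseteq> PIdl (a \<otimes> b \<otimes> c)"
      using ideal_prod_mono[OF ideal_prod_cgenideal_subset[OF carr(1,2)], of "PIdl c"]
        ideal_prod_cgenideal_subset[of "a \<otimes> b" c] carr
      by simp
    show "a \<otimes> b \<in> Q \<or> c \<in> Q"
    proof (rule absorb_of_subset_ideal[OF Q T abc(4)])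
      assume "(PIdl a) \<cdot> (PIdl b) \<cdot> (PIdl c) \<subseteq> Q"
      then show "(PIdl a) \<cdot> (PIdl b) \<subseteq> Q \<or> (PIdl c) \<subseteq> Q"
        using prod abc(1-3) proper_ideal_cgenideal by blast
    next
      show "a \<otimes> b \<in> (PIdl a) \<cdot> (PIdl b)"
        using carr by (simp add: cgenideal_self ideal_prod.prod)
      show "c \<in> PIdl c"
        using cgenideal_self[OF carr(3)] .
    qed
  qed
qed

section \<open>Passing from the submodule to its residual ideals\<close>

lemma (in module) ideal_ring_residual:
  assumes P: "submodule P R M" and m: "m \<in> carrier M"
  shows "ideal (ring_residual R M P {m}) R"
proof (rule idealI)
  show "ring R"
    by (rule R.ring_axioms)
  show "subgroup (ring_residual R M P {m}) (add_monoid R)"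
  proof
    show "\<one>\<^bsub>add_monoid R\<^esub> \<in> ring_residual R M P {m}"
      using m subgroup.one_closed[OF submodule.axioms(1)[OF P]] by (simp add: ring_residual_def)
    fix x assume x: "x \<in> ring_residual R M P {m}"
    show "inv\<^bsub>add_monoid R\<^esub> x \<in> ring_residual R M P {m}"
      using x m submoduleE(3)[OF P]
      by (simp add: ring_residual_def smult_l_minus flip: a_inv_def)
  qed (use m submoduleE(5)[OF P] in \<open>auto simp: ring_residual_def smult_l_distr\<close>)
  fix a x assume "a \<in> ring_residual R M P {m}" "x \<in> carrier R"
  then show "x \<otimes> a \<in> ring_residual R M P {m}" "a \<otimes> x \<in> ring_residual R M P {m}"
    using m submoduleE(4)[OF P] by (auto simp: ring_residual_def smult_assoc1 R.m_comm[of a x])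
qed

lemma mem_ring_residual_iff:
  "x \<in> carrier A \<Longrightarrow> x \<in> ring_residual A M P {m} \<longleftrightarrow> x \<odot>\<^bsub>M\<^esub> m \<in> P"
  by (simp add: ring_residual_def)

lemma set_smult_subset_iff:
  "S \<subseteq> carrier A \<Longrightarrow> set_smult M S m \<subseteq> P \<longleftrightarrow> S \<subseteq> ring_residual A M P {m}"
  by (auto simp: set_smult_def ring_residual_def)

lemma (in module) ring_residual_set_smult:
  assumes "S \<subseteq> carrier R" "m \<in> carrier M"
  shows "ring_residual R M P (set_smult M S m) =
    ideal_quotient R (ring_residual R M P {m}) S"
  using assms smult_assoc1
  by (fastforce simp: ring_residual_def set_smult_def ideal_quotient_def)

lemma classical_one_absorbing_iff:
  assumes A: "cring A" and "proper_submodule P A M"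
  shows "classical_one_absorbing_prime_submodule P A M \<longleftrightarrow>
    (\<forall>m \<in> carrier M. one_absorbing A (ring_residual A M P {m}))"
proof -
  interpret cring A by (rule A)
  show ?thesis
    using assms(2)
    unfolding classical_one_absorbing_prime_submodule_def one_absorbing_def
    by (auto simp: mem_ring_residual_iff nonunits_def)
qed

theorem theorem2:
  fixes A :: "('a, 'x) ring_scheme" (structure)
    and M :: "('a, 'm, 'y) module_scheme"
    and P :: "'m set"
  assumes "module A M"
    and "\<one> \<noteq> \<zero>"
    and "proper_submodule P A M"
  shows
    "(classical_one_absorbing_prime_submodule P A M \<longleftrightarrow>
       (\<forall>a \<in> nonunits A. \<forall>b \<in> nonunits A. \<forall>c \<in> nonunits A.
          module_residual M P (a \<otimes> b \<otimes> c) =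
          module_residual M P (a \<otimes> b) \<union> module_residual M P c)) \<and>
     (classical_one_absorbing_prime_submodule P A M \<longleftrightarrow>
       (\<forall>a \<in> nonunits A. \<forall>b \<in> nonunits A. \<forall>m \<in> carrier M.
          (a \<otimes> b) \<odot>\<^bsub>M\<^esub> m \<notin> P \<longrightarrow>
          ring_residual A M P {(a \<otimes> b) \<odot>\<^bsub>M\<^esub> m} = ring_residual A M P {m})) \<and>
     (classical_one_absorbing_prime_submodule P A M \<longleftrightarrow>
       (\<forall>a \<in> nonunits A. \<forall>b \<in> nonunits A. \<forall>I. proper_ideal I A \<longrightarrow>
          (\<forall>m \<in> carrier M.
             set_smult M ((a <# I) #> b) m \<subseteq> P \<longrightarrow>
             set_smult M (a <# I) m \<subseteq> P \<or> b \<odot>\<^bsub>M\<^esub> m \<in> P))) \<and>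
     (classical_one_absorbing_prime_submodule P A M \<longleftrightarrow>
       (\<forall>a \<in> nonunits A. \<forall>I. proper_ideal I A \<longrightarrow>
          (\<forall>m \<in> carrier M.
             \<not> set_smult M (a <# I) m \<subseteq> P \<longrightarrow>
             ring_residual A M P (set_smult M (a <# I) m) = ring_residual A M P {m}))) \<and>
     (classical_one_absorbing_prime_submodule P A M \<longleftrightarrow>
       (\<forall>a \<in> nonunits A. \<forall>I J. proper_ideal I A \<longrightarrow> proper_ideal J A \<longrightarrow>
          (\<forall>m \<in> carrier M.
             set_smult M (a <# (I \<cdot> J)) m \<subseteq> P \<longrightarrow>
             set_smult M (a <# I) m \<subseteq> P \<or> set_smult M J m \<subseteq> P))) \<and>
     (classical_one_absorbing_prime_submodule P A M \<longleftrightarrow>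
       (\<forall>I J. proper_ideal I A \<longrightarrow> proper_ideal J A \<longrightarrow>
          (\<forall>m \<in> carrier M.
             \<not> set_smult M (I \<cdot> J) m \<subseteq> P \<longrightarrow>
             ring_residual A M P (set_smult M (I \<cdot> J) m) = ring_residual A M P {m}))) \<and>
     (classical_one_absorbing_prime_submodule P A M \<longleftrightarrow>
       (\<forall>I J K. proper_ideal I A \<longrightarrow> proper_ideal J A \<longrightarrow> proper_ideal K A \<longrightarrow>
          (\<forall>m \<in> carrier M.
             set_smult M (I \<cdot> J \<cdot> K) m \<subseteq> P \<longrightarrow>
             set_smult M (I \<cdot> J) m \<subseteq> P \<or> set_smult M K m \<subseteq> P))) \<and>
     (classical_one_absorbing_prime_submodule P A M \<longleftrightarrow>
       (\<forall>m \<in> carrier M - P. one_absorbing_prime_ideal (ring_residual A M P {m}) A))"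
proof -
  interpret module A M
    by (rule assms(1))
  let ?Q = "\<lambda>m. ring_residual A M P {m}"
  have P: "submodule P A M"
    using assms(3) by (simp add: proper_submodule_def)
  have Q: "ideal (?Q m) A" if "m \<in> carrier M" for m
    using ideal_ring_residual[OF P that] .
  note classical = classical_one_absorbing_iff[OF R.is_cring assms(3)]
  have nu: "a \<in> carrier A" if "a \<in> nonunits A" for a
    using that by (simp add: nonunits_def)
  \<comment> \<open>Below, \<open>S m \<subseteq> P\<close> is traded for \<open>S \<subseteq> ?Q m\<close>. This is valid only for sets \<open>S\<close> of scalars, because
    \<open>?Q m\<close> lies in the carrier; the next facts provide this for the sets that occur.\<close>
  have aI: "a <# I \<subseteq> carrier A" if "a \<in> nonunits A" "proper_ideal I A" for a I
    using that nu R.l_coset_subset_carrier proper_ideal_subset_carrier by blast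
  have aIb: "(a <# I) #> b \<subseteq> carrier A"
    if "a \<in> nonunits A" "b \<in> nonunits A" "proper_ideal I A" for a b I
    using aI[OF that(1,3)] nu[OF that(2)] by (auto simp: r_coset_def)
  have IJ: "ideal (I \<cdot> J) A" if "proper_ideal I A" "proper_ideal J A" for I J
    using that by (simp add: proper_ideal_def R.ideal_prod_is_ideal)
  have IJc: "I \<cdot> J \<subseteq> carrier A" if "proper_ideal I A" "proper_ideal J A" for I J
    using that by (simp add: proper_ideal_def R.ideal_prod_in_carrier)
  have aIJ: "a <# (I \<cdot> J) \<subseteq> carrier A"
    if "a \<in> nonunits A" "proper_ideal I A" "proper_ideal J A" for a I J
    using nu[OF that(1)] IJc[OF that(2,3)] R.l_coset_subset_carrier by blast
  have IJK: "I \<cdot> J \<cdot> K \<subseteq> carrier A"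
    if "proper_ideal I A" "proper_ideal J A" "proper_ideal K A" for I J K
    using IJ[OF that(1,2)] that(3) by (simp add: proper_ideal_def R.ideal_prod_in_carrier)
  note Ic = proper_ideal_subset_carrier[of _ A]
  note subset = set_smult_subset_iff[of _ A M _ P]

  have "classical_one_absorbing_prime_submodule P A M \<longleftrightarrow>
       (\<forall>a \<in> nonunits A. \<forall>b \<in> nonunits A. \<forall>c \<in> nonunits A.
          module_residual M P (a \<otimes> b \<otimes> c) =
          module_residual M P (a \<otimes> b) \<union> module_residual M P c)"
  proof -
    have "module_residual M P (a \<otimes> b \<otimes> c) = module_residual M P (a \<otimes> b) \<union> module_residual M P c
        \<longleftrightarrow> (\<forall>m \<in> carrier M. a \<otimes> b \<otimes> c \<in> ?Q m \<longleftrightarrow> a \<otimes> b \<in> ?Q m \<or> c \<in> ?Q m)"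
      if "a \<in> nonunits A" "b \<in> nonunits A" "c \<in> nonunits A" for a b c
      using nu[OF that(1)] nu[OF that(2)] nu[OF that(3)]
      by (auto simp: module_residual_def mem_ring_residual_iff)
    then show ?thesis
      unfolding classical by (auto simp: R.one_absorbing_iff_union[OF Q])
  qed
  moreover have "classical_one_absorbing_prime_submodule P A M \<longleftrightarrow>
       (\<forall>a \<in> nonunits A. \<forall>b \<in> nonunits A. \<forall>m \<in> carrier M.
          (a \<otimes> b) \<odot>\<^bsub>M\<^esub> m \<notin> P \<longrightarrow>
          ring_residual A M P {(a \<otimes> b) \<odot>\<^bsub>M\<^esub> m} = ring_residual A M P {m})"
  proof -
    have "ring_residual A M P {p \<odot>\<^bsub>M\<^esub> m} = ideal_quotient A (?Q m) {p}"
      if "p \<in> carrier A" "m \<in> carrier M" for p m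
      using ring_residual_set_smult[of "{p}" m P] that by (simp add: set_smult_def)
    then show ?thesis
      unfolding classical
      by (auto simp: R.one_absorbing_iff_quotient_element[OF Q] mem_ring_residual_iff nu)
  qed
  moreover have "classical_one_absorbing_prime_submodule P A M \<longleftrightarrow>
       (\<forall>a \<in> nonunits A. \<forall>b \<in> nonunits A. \<forall>I. proper_ideal I A \<longrightarrow>
          (\<forall>m \<in> carrier M.
             set_smult M ((a <# I) #> b) m \<subseteq> P \<longrightarrow>
             set_smult M (a <# I) m \<subseteq> P \<or> b \<odot>\<^bsub>M\<^esub> m \<in> P))"
    unfolding classical
    by (simp add: R.one_absorbing_iff_element_ideal_element[OF Q] subset aI aIb
        mem_ring_residual_iff nu cong: ball_cong) blast
  moreover have "classical_one_absorbing_prime_submodule P A M \<longleftrightarrow>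
       (\<forall>a \<in> nonunits A. \<forall>I. proper_ideal I A \<longrightarrow>
          (\<forall>m \<in> carrier M.
             \<not> set_smult M (a <# I) m \<subseteq> P \<longrightarrow>
             ring_residual A M P (set_smult M (a <# I) m) = ring_residual A M P {m}))"
    unfolding classical
    by (simp add: R.one_absorbing_iff_quotient_element_ideal[OF Q] subset aI
        ring_residual_set_smult cong: ball_cong) blast
  moreover have "classical_one_absorbing_prime_submodule P A M \<longleftrightarrow>
       (\<forall>a \<in> nonunits A. \<forall>I J. proper_ideal I A \<longrightarrow> proper_ideal J A \<longrightarrow>
          (\<forall>m \<in> carrier M.
             set_smult M (a <# (I \<cdot> J)) m \<subseteq> P \<longrightarrow>
             set_smult M (a <# I) m \<subseteq> P \<or> set_smult M J m \<subseteq> P))"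
    unfolding classical
    by (simp add: R.one_absorbing_iff_element_ideal_ideal[OF Q] subset aI aIJ Ic
        cong: ball_cong) blast
  moreover have "classical_one_absorbing_prime_submodule P A M \<longleftrightarrow>
       (\<forall>I J. proper_ideal I A \<longrightarrow> proper_ideal J A \<longrightarrow>
          (\<forall>m \<in> carrier M.
             \<not> set_smult M (I \<cdot> J) m \<subseteq> P \<longrightarrow>
             ring_residual A M P (set_smult M (I \<cdot> J) m) = ring_residual A M P {m}))"
    unfolding classical
    by (simp add: R.one_absorbing_iff_quotient_ideal_ideal[OF Q] subset IJc
        ring_residual_set_smult cong: ball_cong) blast
  moreover have "classical_one_absorbing_prime_submodule P A M \<longleftrightarrow>
       (\<forall>I J K. proper_ideal I A \<longrightarrow> proper_ideal J A \<longrightarrow> proper_ideal K A \<longrightarrow>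
          (\<forall>m \<in> carrier M.
             set_smult M (I \<cdot> J \<cdot> K) m \<subseteq> P \<longrightarrow>
             set_smult M (I \<cdot> J) m \<subseteq> P \<or> set_smult M K m \<subseteq> P))"
    unfolding classical
    by (simp add: R.one_absorbing_iff_ideal_ideal_ideal[OF Q] subset IJc IJK Ic
        cong: ball_cong) blast
  moreover have "classical_one_absorbing_prime_submodule P A M \<longleftrightarrow>
       (\<forall>m \<in> carrier M - P. one_absorbing_prime_ideal (ring_residual A M P {m}) A)"
  proof -
    \<comment> \<open>For \<open>m \<in> P\<close> the residual is the whole ring.\<close>
    have "one_absorbing A (?Q m)" if "m \<in> P" for m
      using that nu submoduleE(4)[OF P]
      by (auto simp: one_absorbing_def mem_ring_residual_iff)
    moreover have "proper_ideal (?Q m) A" if "m \<in> carrier M - P" for m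
    proof -
      have "\<one> \<notin> ?Q m"
        using that by (simp add: ring_residual_def)
      then show ?thesis
        using Q[of m] that by (auto simp: proper_ideal_def)
    qed
    ultimately show ?thesis
      unfolding classical one_absorbing_prime_ideal_def one_absorbing_def[symmetric] by blast
  qed
  ultimately show ?thesis
    by (intro conjI)
qed

end
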